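(* Let $m\ge1$ be an integer and let $\alpha\in(0,m)$ be real. Let $D$ be a random variable with values in $\{m,m+1,m+2,\dots\}$, with $\mathbb{P}(D=m)>0$, whose distribution is specified by $$\frac{\mathbb{P}(D=k+1)}{\mathbb{P}(D=k)}=\frac{k-\alpha}{k+1}\quad\text{for all integers } k\ge m.$$ Then the distribution of $D$ is infinitely divisible.
   Context: Infinitely divisible is meant in the usual sense for distributions on $\mathbb{R}$: for every integer $n\ge1$, $D$ is equal in distribution to a sum of $n$ i.i.d. real-valued random variables. When $\alpha$ is not an integer, the distribution of $D$ is equivalently specified by its probability generating function $$\mathbb{E}s^D=\frac{1-(1-s)^\alpha-\sum_{1\le k<m}c_k(\alpha)s^k}{1-\sum_{1\le k<m}c_k(\alpha)},\qquad c_k(\alpha)=\frac{(-1)^{k-1}\alpha(\alpha-1)\cdots(\alpha-k+1)}{k!}.$$ *)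

theory Defs
  imports "HOL-Probability.Probability"
begin

text \<open>
  A distribution is infinitely divisible if for every \<open>n \<ge> 1\<close> it is the law of a sum of \<open>n\<close>
  i.i.d. real random variables. The sample space of these variables is existentially
  quantified over measures on \<^typ>\<open>nat \<Rightarrow> real\<close>. Fixing this type loses nothing, since the joint
  law of any i.i.d. family \<open>X 0, \<dots>, X (n - 1)\<close> can be realised there as a product measure.
\<close>

definition infinitely_divisible :: "real measure \<Rightarrow> bool" where
  "infinitely_divisible \<mu> \<longleftrightarrow>
    (\<forall>n::nat. n \<ge> 1 \<longrightarrow>
      (\<exists>(\<Omega> :: (nat \<Rightarrow> real) measure) (X :: nat \<Rightarrow> (nat \<Rightarrow> real) \<Rightarrow> real).
        prob_space \<Omega> \<and>
        prob_space.indep_vars \<Omega> (\<lambda>_. borel) X {..<n} \<and>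
        (\<forall>i<n. distr \<Omega> borel (X i) = distr \<Omega> borel (X 0)) \<and>
        \<mu> = distr \<Omega> borel (\<lambda>\<omega>. \<Sum>i<n. X i \<omega>)))"

end

theory Submission
  imports Defs
begin

text \<open>
  Write \<open>p j\<close> for the probability that \<open>D = m + j\<close>. The prescribed ratios
  \<open>(k - \<alpha>) / (k + 1) = 1 - (1 + \<alpha>) / (k + 1)\<close> increase with \<open>k\<close>, so \<open>p\<close> is log-convex,
  and they are positive for \<open>k \<ge> m > \<alpha>\<close>, so \<open>p\<close> has no zeros. It is a classical fact
  that a log-convex distribution on the naturals is infinitely divisible, and translating it by
  \<open>m\<close> preserves this: each of the \<open>n\<close> summands is translated by \<open>m / n\<close>.

  The classical fact is proved with formal power series. Let \<open>f\<close> be the generating series of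
  \<open>p\<close> and \<open>r = f' / f\<close> its logarithmic derivative. The recurrence \<open>r * f = f'\<close> expresses each
  coefficient of \<open>r\<close> through the earlier ones, and log-convexity keeps them nonnegative
  (\<open>log_convex_imp_log_deriv_nonneg\<close>). A formal \<open>n\<close>-th root \<open>g\<close> of \<open>f\<close> satisfies
  \<open>n * g' = r * g\<close>, so its coefficients are nonnegative too (\<open>nonneg_fps_root\<close>). They sum
  to \<open>1\<close> (\<open>fps_root_of_pmf\<close>), so they are the probabilities of a distribution whose
  \<open>n\<close>-fold convolution is \<open>p\<close>. This last identity is transferred from series to laws
  of independent sums through characteristic functions (\<open>infinitely_divisible_log_convex\<close>).
\<close>

section \<open>Nonnegative roots of power series\<close>

text \<open>
  Comparing coefficients in \<open>r * f = f'\<close>, where \<open>f\<close> is the generating series of \<open>p\<close>, gives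
  \<open>r (l + 1) * p 0 = (l + 2) * p (l + 2) - (\<Sum>i\<le>l. r i * p (l + 1 - i))\<close>.
  The ratios \<open>\<rho> j = p (j + 1) / p j\<close> increase, so replacing \<open>p (l + 1 - i)\<close> by
  \<open>\<rho> l * p (l - i)\<close> only enlarges the sum on the right. By the recurrence one step
  earlier the enlarged sum equals \<open>\<rho> l * (l + 1) * p (l + 1)\<close>, and this is at most
  \<open>(l + 1) * p (l + 2)\<close>.
\<close>

lemma log_convex_imp_log_deriv_nonneg:
  fixes p :: "nat \<Rightarrow> real"
  assumes pos: "\<And>j. 0 < p j"
    and log_convex: "\<And>j. p (Suc j) ^ 2 \<le> p j * p (Suc (Suc j))"
  shows "0 \<le> fps_nth (fps_deriv (Abs_fps p) * inverse (Abs_fps p)) k"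
proof -
  define r where "r = fps_deriv (Abs_fps p) * inverse (Abs_fps p)"
  have "r * Abs_fps p = fps_deriv (Abs_fps p)"
    using pos[of 0] by (simp add: r_def mult.assoc inverse_mult_eq_1)
  then have rec: "(\<Sum>i\<le>k. fps_nth r i * p (k - i)) = real (Suc k) * p (Suc k)" for k
    by (simp add: fps_eq_iff fps_mult_nth atLeast0AtMost)
  define \<rho> where "\<rho> j = p (Suc j) / p j" for j
  have p_Suc: "p (Suc j) = \<rho> j * p j" for j
    using pos[of j] by (simp add: \<rho>_def)
  have "\<rho> j \<le> \<rho> (Suc j)" for j
    using log_convex[of j] pos[of j] pos[of "Suc j"]
    by (simp add: \<rho>_def divide_simps power2_eq_square mult.commute)
  then have \<rho>_mono: "i \<le> j \<Longrightarrow> \<rho> i \<le> \<rho> j" for i j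
    by (rule lift_Suc_mono_le)
  have "0 \<le> fps_nth r k"
  proof (induction k rule: less_induct)
    case (less k)
    show ?case
    proof (cases k)
      case 0
      then show ?thesis
        using rec[of 0] pos[of 0] pos[of 1] zero_le_mult_iff[of "fps_nth r 0" "p 0"] by auto
    next
      case (Suc l)
      have "(\<Sum>i\<le>l. fps_nth r i * p (Suc l - i)) \<le> (\<Sum>i\<le>l. \<rho> l * (fps_nth r i * p (l - i)))"
      proof (rule sum_mono)
        fix i assume "i \<in> {..l}"
        then have "p (Suc l - i) \<le> \<rho> l * p (l - i)"
          using p_Suc[of "l - i"] \<rho>_mono[of "l - i" l] pos[of "l - i"] by (simp add: Suc_diff_le)
        then show "fps_nth r i * p (Suc l - i) \<le> \<rho> l * (fps_nth r i * p (l - i))"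
          using mult_left_mono[of "p (Suc l - i)" "\<rho> l * p (l - i)" "fps_nth r i"]
            less[of i] \<open>i \<in> {..l}\<close> Suc by (simp add: mult.left_commute)
      qed
      also have "\<dots> = \<rho> l * (real (Suc l) * p (Suc l))"
        by (simp only: rec flip: sum_distrib_left)
      also have "\<dots> \<le> real (Suc l) * p (Suc (Suc l))"
        using mult_right_mono[OF \<rho>_mono[of l "Suc l"], of "real (Suc l) * p (Suc l)"] pos[of "Suc l"]
        by (simp add: p_Suc[of "Suc l"] mult_ac)
      also have "\<dots> \<le> real (Suc (Suc l)) * p (Suc (Suc l))"
        using pos[of "Suc (Suc l)"] by simp
      finally have "0 \<le> fps_nth r (Suc l) * p 0"
        using rec[of "Suc l"] by simp
      then show ?thesis
        using pos[of 0] Suc by (simp add: zero_le_mult_iff)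
    qed
  qed
  then show ?thesis by (simp add: r_def)
qed

text \<open>
  Differentiating \<open>g ^ n = f\<close> and cancelling \<open>g ^ (n - 1)\<close> yields \<open>n * g' = r * g\<close> with
  \<open>r = f' / f\<close>. This is a recurrence with nonnegative coefficients for the coefficients of \<open>g\<close>.
\<close>

lemma nonneg_fps_root:
  fixes f :: "real fps"
  assumes pos: "0 < fps_nth f 0"
    and log_deriv: "\<And>k. 0 \<le> fps_nth (fps_deriv f * inverse f) k"
    and n: "0 < n"
  obtains g where "g ^ n = f" and "0 < fps_nth g 0" and "\<And>k. 0 \<le> fps_nth g k"
proof -
  obtain m where m: "n = Suc m"
    using n by (cases n) auto
  define g where "g = fps_radical root n f"
  have root: "root n (fps_nth f 0) ^ n = fps_nth f 0"
    using pos n by simp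
  then have power: "g ^ n = f"
    using power_radical[of f root m] pos by (simp add: g_def m)
  have g0: "0 < fps_nth g 0"
    using pos n by (simp add: g_def m)
  define r where "r = fps_deriv f * inverse f"
  have "r * f = fps_deriv f"
    using pos by (simp add: r_def mult.assoc inverse_mult_eq_1)
  also have "\<dots> = of_nat n * g ^ m * fps_deriv g"
    by (simp only: m fps_deriv_power' mult_ac diff_Suc_1 flip: power)
  finally have "g ^ m * (r * g) = g ^ m * (of_nat n * fps_deriv g)"
    by (simp only: m power_Suc mult_ac flip: power)
  moreover have "g ^ m \<noteq> 0"
    using g0 by auto
  ultimately have "r * g = of_nat n * fps_deriv g"
    by (simp only: mult_cancel_left simp_thms)
  then have "r * g = fps_const (real n) * fps_deriv g"
    by (simp add: fps_of_nat)
  then have "fps_nth (r * g) k = fps_nth (fps_const (real n) * fps_deriv g) k" for k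
    by simp
  then have rec: "(\<Sum>i\<le>k. fps_nth r i * fps_nth g (k - i)) = real n * (real (Suc k) * fps_nth g (Suc k))" for k
    by (simp add: fps_mult_nth[of r g] atLeast0AtMost)
  have "0 \<le> fps_nth g k" for k
  proof (induction k rule: less_induct)
    case (less k)
    show ?case
    proof (cases k)
      case (Suc l)
      have "0 \<le> (\<Sum>i\<le>l. fps_nth r i * fps_nth g (l - i))"
        using log_deriv less Suc by (intro sum_nonneg mult_nonneg_nonneg) (auto simp: r_def)
      then show ?thesis
        unfolding rec using n Suc by (simp add: zero_le_mult_iff)
    qed (use g0 in simp)
  qed
  with power g0 show thesis by (rule that)
qed

section \<open>Evaluation of powers on the closed unit disc\<close>

text \<open>
  Iterated Cauchy products. Absolute convergence is carried through the induction because the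
  Cauchy product needs it at the next step.
\<close>

lemma fps_power_sums:
  fixes g :: "real fps" and z :: complex
  assumes nonneg: "\<And>k. 0 \<le> fps_nth g k" and summable: "summable (fps_nth g)"
    and z: "norm z \<le> 1"
  shows "summable (\<lambda>k. norm (of_real (fps_nth (g ^ n) k) * z ^ k)) \<and>
    (\<lambda>k. of_real (fps_nth (g ^ n) k) * z ^ k) sums (\<Sum>k. of_real (fps_nth g k) * z ^ k) ^ n"
proof (induction n)
  case 0
  have *: "of_real (fps_nth 1 k) * z ^ k = (if k = 0 then 1 else 0)" for k
    by auto
  have "(\<lambda>k::nat. if k = 0 then 1 else 0 :: complex) sums 1"
    using sums_single[of 0 "\<lambda>_. 1::complex"] by simp
  moreover have "summable (\<lambda>k::nat. norm (if k = 0 then 1 else 0 :: complex))"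
    by (rule summable_finite[of "{0}"]) auto
  ultimately show ?case unfolding power_0 * by simp
next
  case (Suc n)
  let ?a = "\<lambda>k. of_real (fps_nth g k) * z ^ k"
  let ?b = "\<lambda>k. of_real (fps_nth (g ^ n) k) * z ^ k"
  have a: "summable (\<lambda>k. norm (?a k))"
    using summable
    by (rule summable_comparison_test'[where N = 0])
      (use nonneg z in \<open>auto simp: norm_mult norm_power mult_left_le power_le_one\<close>)
  have b: "summable (\<lambda>k. norm (?b k))" and b': "(\<Sum>k. ?b k) = (\<Sum>k. ?a k) ^ n"
    using Suc by (auto simp: sums_iff)
  have conv: "(\<Sum>i\<le>k. ?a i * ?b (k - i)) = of_real (fps_nth (g ^ Suc n) k) * z ^ k" for k
    unfolding power_Suc fps_mult_nth of_real_sum sum_distrib_right atLeast0AtMost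
    by (rule sum.cong) (auto simp: mult_ac simp flip: power_add)
  have "summable (\<lambda>k. \<Sum>i\<le>k. norm (?a i) * norm (?b (k - i)))"
    using summable_Cauchy_product[of "\<lambda>k. norm (?a k)" "\<lambda>k. norm (?b k)"] a b by simp
  then have "summable (\<lambda>k. norm (\<Sum>i\<le>k. ?a i * ?b (k - i)))"
    by (rule summable_comparison_test'[where N = 0])
      (auto intro!: order_trans[OF norm_sum] simp: norm_mult)
  moreover have "(\<lambda>k. \<Sum>i\<le>k. ?a i * ?b (k - i)) sums ((\<Sum>k. ?a k) * (\<Sum>k. ?a k) ^ n)"
    using Cauchy_product_sums[OF a b] b' by simp
  ultimately show ?case
    unfolding conv by simp
qed

lemma fps_power_nonneg:
  fixes g :: "real fps"
  assumes "\<And>k. 0 \<le> fps_nth g k"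
  shows "0 \<le> fps_nth (g ^ n) k"
  using assms by (induction n arbitrary: k) (auto simp: fps_mult_nth intro!: sum_nonneg)

lemma fps_power_nth_ge:
  fixes g :: "real fps"
  assumes nonneg: "\<And>k. 0 \<le> fps_nth g k"
  shows "fps_nth g 0 ^ n * fps_nth g k \<le> fps_nth (g ^ Suc n) k"
proof (induction n)
  case (Suc n)
  have "fps_nth g 0 ^ Suc n * fps_nth g k \<le> fps_nth g 0 * fps_nth (g ^ Suc n) k"
    using mult_left_mono[OF Suc nonneg[of 0]] by (simp add: mult.assoc)
  also have "\<dots> \<le> (\<Sum>i=0..k. fps_nth g i * fps_nth (g ^ Suc n) (k - i))"
    using sum_mono2[of "{0..k}" "{0}" "\<lambda>i. fps_nth g i * fps_nth (g ^ Suc n) (k - i)"]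
      nonneg fps_power_nonneg[OF nonneg, of "Suc n"] by (auto simp del: power_Suc)
  finally show ?case
    by (simp add: fps_mult_nth)
qed simp

section \<open>Distributions on the naturals\<close>

lemma pmf_nat_sums:
  fixes p :: "nat pmf"
  shows "pmf p sums 1"
  using sums_integral_count_space_nat[of "pmf p"]
  by (simp add: integrable_pmf integral_pmf measure_pmf.prob_space[simplified])

text \<open>
  A nonnegative root of a probability generating function is again one. Its coefficients are
  dominated by a multiple of those of \<^term>\<open>p\<close>, because the \<open>n\<close>-fold convolution contains the
  term \<open>g 0 ^ (n - 1) * g k\<close>; hence they have a finite sum, and the \<open>n\<close>-th power of this sum
  is the total mass \<open>1\<close> of \<^term>\<open>p\<close>.
\<close>

lemma fps_root_of_pmf:
  fixes p :: "nat pmf" and g :: "real fps"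
  assumes power: "g ^ n = Abs_fps (pmf p)"
    and nonneg: "\<And>k. 0 \<le> fps_nth g k" and g0: "0 < fps_nth g 0" and n: "0 < n"
  obtains q where "fps_nth g = pmf q"
proof -
  obtain m where m: "n = Suc m"
    using n by (cases n) auto
  have "fps_nth g k \<le> pmf p k / fps_nth g 0 ^ m" for k
    using fps_power_nth_ge[of g m k, OF nonneg] g0 power
    by (simp add: m field_simps del: power_Suc)
  then have summable: "summable (fps_nth g)"
    using nonneg
    by (intro summable_comparison_test'[OF summable_divide[OF sums_summable[OF pmf_nat_sums]], where N = 0]) simp
  have "(\<lambda>k. complex_of_real (pmf p k)) sums (\<Sum>k. complex_of_real (fps_nth g k)) ^ n"
    using fps_power_sums[OF nonneg summable, of 1 n] power by simp
  moreover have "(\<lambda>k. complex_of_real (pmf p k)) sums complex_of_real 1"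
    using pmf_nat_sums by (rule sums_of_real)
  ultimately have "complex_of_real ((\<Sum>k. fps_nth g k) ^ n) = complex_of_real 1"
    unfolding of_real_power suminf_of_real[OF summable] by (rule sums_unique2)
  then have "(\<Sum>k. fps_nth g k) ^ n = 1"
    unfolding of_real_eq_iff .
  then have "(\<Sum>k. fps_nth g k) = 1"
    using n suminf_nonneg[OF summable nonneg] power_eq_1_iff by fastforce
  then have "(\<integral>\<^sup>+ k. ennreal (fps_nth g k) \<partial>count_space UNIV) = 1"
    using suminf_ennreal2[OF nonneg summable] by (simp add: nn_integral_count_space_nat)
  then have "pmf (embed_pmf (fps_nth g)) = fps_nth g"
    by (intro ext pmf_embed_pmf nonneg)
  then show thesis
    by (intro that[of "embed_pmf (fps_nth g)"]) simp
qed

lemma char_distr_nat_pmf: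
  fixes p :: "nat pmf"
  shows "char (distr p borel (\<lambda>k. c + real k)) t = iexp (t * c) * (\<Sum>k. of_real (pmf p k) * iexp t ^ k)"
proof -
  have norm: "norm (of_real (pmf p k) * iexp t ^ k :: complex) = pmf p k" for k
    by (simp add: norm_mult norm_power)
  have int: "integrable (count_space UNIV) (\<lambda>k. complex_of_real (pmf p k) * iexp t ^ k)"
    by (rule Bochner_Integration.integrable_bound[OF integrable_pmf[of UNIV p]]) (auto simp: norm)
  have "char (distr p borel (\<lambda>k. c + real k)) t = (CLINT k|p. iexp (t * c) * iexp t ^ k)"
    by (simp add: char_def integral_distr exp_add algebra_simps flip: exp_of_nat_mult)
  also have "\<dots> = iexp (t * c) * (CLINT k|p. iexp t ^ k)"
    by simp
  also have "(CLINT k|p. iexp t ^ k) = (CLINT k|count_space UNIV. pmf p k *\<^sub>R iexp t ^ k)"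
    unfolding measure_pmf_eq_density by (rule integral_density) auto
  also have "\<dots> = (\<Sum>k. of_real (pmf p k) * iexp t ^ k)"
    using int by (simp add: scaleR_conv_of_real integral_count_space_nat)
  finally show ?thesis .
qed

text \<open>
  The shift \<open>c\<close> is part of the statement so that translates need no separate treatment: a
  summand has law \<open>q\<close> translated by \<open>c / n\<close>, where the probabilities of \<open>q\<close> are the
  coefficients of the \<open>n\<close>-th root.
\<close>

lemma infinitely_divisible_log_convex:
  fixes p :: "nat pmf" and c :: real
  assumes pos: "\<And>j. 0 < pmf p j"
    and log_convex: "\<And>j. pmf p (Suc j) ^ 2 \<le> pmf p j * pmf p (Suc (Suc j))"
  shows "infinitely_divisible (distr p borel (\<lambda>k. c + real k))"
  unfolding infinitely_divisible_def
proof (intro allI impI)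
  fix n :: nat assume "n \<ge> 1"
  then have n: "0 < n" by simp
  obtain g where g: "g ^ n = Abs_fps (pmf p)" "0 < fps_nth g 0" "\<And>k. 0 \<le> fps_nth g k"
    using nonneg_fps_root[of "Abs_fps (pmf p)" n]
      log_convex_imp_log_deriv_nonneg[of "pmf p"] pos log_convex n by auto
  obtain q where q: "fps_nth g = pmf q"
    using fps_root_of_pmf[OF g(1,3,2) n] .
  define \<nu> where "\<nu> = distr q borel (\<lambda>k. c / real n + real k)"
  interpret \<nu>: real_distribution \<nu>
    unfolding \<nu>_def by (intro prob_space.real_distribution_distr measure_pmf.prob_space_axioms) simp
  define \<Omega> where "\<Omega> = PiM {..<n} (\<lambda>_. \<nu>)"
  interpret \<Omega>: prob_space \<Omega>
    unfolding \<Omega>_def by (intro prob_space_PiM \<nu>.prob_space_axioms)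
  have sets_\<Omega>: "sets \<Omega> = sets (PiM {..<n} (\<lambda>_. borel))"
    unfolding \<Omega>_def by (intro sets_PiM_cong) auto
  have coordinate: "(\<lambda>\<omega>. \<omega> i) \<in> borel_measurable \<Omega>" if "i < n" for i
    using that unfolding measurable_cong_sets[OF sets_\<Omega> refl] by simp
  have marginal: "distr \<Omega> borel (\<lambda>\<omega>. \<omega> i) = \<nu>" if "i < n" for i
  proof -
    have "distr \<Omega> borel (\<lambda>\<omega>. \<omega> i) = distr \<Omega> \<nu> (\<lambda>\<omega>. \<omega> i)"
      by (rule distr_cong) auto
    also have "\<dots> = \<nu>"
      unfolding \<Omega>_def using that by (intro distr_PiM_component \<nu>.prob_space_axioms) auto
    finally show ?thesis .
  qed
  \<comment> \<open>Points of the product space are already extensional, so restricting them changes nothing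
    and the joint law of the coordinates is the product measure itself.\<close>
  have "distr \<Omega> (PiM {..<n} (\<lambda>_. borel)) (\<lambda>\<omega>. \<lambda>i\<in>{..<n}. \<omega> i) = distr \<Omega> \<Omega> (\<lambda>\<omega>. \<omega>)"
    by (rule distr_cong[OF refl sets_\<Omega>[symmetric]]) (simp add: \<Omega>_def space_PiM PiE_restrict)
  also have "\<dots> = \<Omega>"
    by (rule distr_id)
  also have "\<Omega> = PiM {..<n} (\<lambda>i. distr \<Omega> borel (\<lambda>\<omega>. \<omega> i))"
    by (subst (1) \<Omega>_def) (rule PiM_cong, auto simp: marginal)
  finally have indep: "\<Omega>.indep_vars (\<lambda>_. borel) (\<lambda>i \<omega>. \<omega> i) {..<n}"
    using n coordinate by (subst \<Omega>.indep_vars_iff_distr_eq_PiM') auto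
  have "distr p borel (\<lambda>k. c + real k) = distr \<Omega> borel (\<lambda>\<omega>. \<Sum>i<n. \<omega> i)"
  proof (rule Levy_uniqueness)
    show "real_distribution (distr p borel (\<lambda>k. c + real k))"
      by (intro prob_space.real_distribution_distr measure_pmf.prob_space_axioms) simp
    show "real_distribution (distr \<Omega> borel (\<lambda>\<omega>. \<Sum>i<n. \<omega> i))"
      using coordinate by (intro \<Omega>.real_distribution_distr borel_measurable_sum) auto
    have summable: "summable (fps_nth g)"
      unfolding q using pmf_nat_sums by (rule sums_summable)
    show "char (distr p borel (\<lambda>k. c + real k)) = char (distr \<Omega> borel (\<lambda>\<omega>. \<Sum>i<n. \<omega> i))"
    proof
      fix t :: real
      have "char (distr \<Omega> borel (\<lambda>\<omega>. \<Sum>i<n. \<omega> i)) t = char \<nu> t ^ n"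
        using \<Omega>.char_distr_sum[OF indep] by (simp add: marginal)
      also have "\<dots> = iexp (t * c) * (\<Sum>k. of_real (fps_nth g k) * iexp t ^ k) ^ n"
        using n by (simp add: \<nu>_def char_distr_nat_pmf q power_mult_distrib flip: exp_of_nat_mult)
      also have "\<dots> = iexp (t * c) * (\<Sum>k. of_real (pmf p k) * iexp t ^ k)"
        using fps_power_sums[OF g(3) summable, of "iexp t" n] g(1) by (simp add: sums_iff)
      also have "\<dots> = char (distr p borel (\<lambda>k. c + real k)) t"
        by (simp add: char_distr_nat_pmf)
      finally show "char (distr p borel (\<lambda>k. c + real k)) t = char (distr \<Omega> borel (\<lambda>\<omega>. \<Sum>i<n. \<omega> i)) t" ..
    qed
  qed
  then show "\<exists>(\<Omega> :: (nat \<Rightarrow> real) measure) X.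
      prob_space \<Omega> \<and>
      prob_space.indep_vars \<Omega> (\<lambda>_. borel) X {..<n} \<and>
      (\<forall>i<n. distr \<Omega> borel (X i) = distr \<Omega> borel (X 0)) \<and>
      distr p borel (\<lambda>k. c + real k) = distr \<Omega> borel (\<lambda>\<omega>. \<Sum>i<n. X i \<omega>)"
    using \<Omega>.prob_space_axioms indep marginal n
    by (intro exI[of _ \<Omega>] exI[of _ "\<lambda>i \<omega>. \<omega> i"]) simp
qed

section \<open>The distribution with ratios \<open>(k - \<alpha>) / (k + 1)\<close>\<close>

theorem corollary9:
  fixes M :: "'a measure" and D :: "'a \<Rightarrow> nat" and m :: nat and \<alpha> :: real
  assumes "prob_space M"
    and "m \<ge> 1"
    and "0 < \<alpha>" and "\<alpha> < real m"
    and "D \<in> measurable M (count_space UNIV)"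
    and "\<forall>\<omega>\<in>space M. m \<le> D \<omega>"
    and "measure M {\<omega> \<in> space M. D \<omega> = m} > 0"
    and "\<forall>k\<ge>m. measure M {\<omega> \<in> space M. D \<omega> = k + 1} / measure M {\<omega> \<in> space M. D \<omega> = k}
                  = (real k - \<alpha>) / (real k + 1)"
  shows "infinitely_divisible (distr M borel (\<lambda>\<omega>. real (D \<omega>)))"
proof -
  interpret prob_space M by fact
  note [measurable] = \<open>D \<in> measurable M (count_space UNIV)\<close>
  \<comment> \<open>Truncated subtraction is harmless here because \<open>D\<close> is at least \<open>m\<close>.\<close>
  define N where "N = distr M (count_space UNIV) (\<lambda>\<omega>. D \<omega> - m)"
  interpret N: prob_space N
    unfolding N_def by (rule prob_space_distr) simp
  define p where "p = Abs_pmf N"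
  have sets_N: "sets N = UNIV"
    by (simp add: N_def)
  then have "AE k in N. measure N {k} \<noteq> 0"
    by (subst N.AE_support_countable) auto
  with sets_N N.prob_space_axioms have p: "measure_pmf p = N"
    unfolding p_def by (intro Abs_pmf_inverse) simp
  have pmf_p: "pmf p j = prob {\<omega> \<in> space M. D \<omega> = m + j}" for j
  proof -
    have "pmf p j = prob ((\<lambda>\<omega>. D \<omega> - m) -` {j} \<inter> space M)"
      by (simp add: pmf.rep_eq p N_def measure_distr)
    also have "(\<lambda>\<omega>. D \<omega> - m) -` {j} \<inter> space M = {\<omega> \<in> space M. D \<omega> = m + j}"
      using \<open>\<forall>\<omega>\<in>space M. m \<le> D \<omega>\<close> by force
    finally show ?thesis .
  qed
  have ratio: "pmf p (Suc j) / pmf p j = (real (m + j) - \<alpha>) / (real (m + j) + 1)" for j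
    using assms(8)[rule_format, of "m + j"] by (simp add: pmf_p)
  have pos: "0 < pmf p j" for j
  proof (induction j)
    case 0
    then show ?case using assms(7) by (simp add: pmf_p)
  next
    case (Suc j)
    have "0 < pmf p (Suc j) / pmf p j"
      unfolding ratio using \<open>\<alpha> < real m\<close> by simp
    then show ?case
      using Suc by (simp add: zero_less_divide_iff)
  qed
  have "pmf p (Suc j) ^ 2 \<le> pmf p j * pmf p (Suc (Suc j))" for j
  proof -
    have "(real (m + j) - \<alpha>) / (real (m + j) + 1) \<le> (real (m + Suc j) - \<alpha>) / (real (m + Suc j) + 1)"
      using \<open>0 < \<alpha>\<close> by (simp add: divide_simps) (simp add: algebra_simps)
    then have "pmf p (Suc j) / pmf p j \<le> pmf p (Suc (Suc j)) / pmf p (Suc j)"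
      by (simp only: ratio)
    then show ?thesis
      using pos[of j] pos[of "Suc j"] by (simp add: divide_simps power2_eq_square mult.commute)
  qed
  with pos have "infinitely_divisible (distr p borel (\<lambda>k. real m + real k))"
    by (rule infinitely_divisible_log_convex)
  also have "distr p borel (\<lambda>k. real m + real k) = distr M borel (\<lambda>\<omega>. real (D \<omega>))"
    unfolding p N_def using \<open>\<forall>\<omega>\<in>space M. m \<le> D \<omega>\<close>
    by (subst distr_distr) (auto intro!: distr_cong simp: comp_def)
  finally show ?thesis .
qed

end
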